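(* If $\beta\geq 1$ is a real number and $b>a\geq 1$ are integers, then $$\binom{b+\beta a}{b} \, \geq \, \binom{a+\beta b}{a} \, .$$
   Context: For a real number $x$ and a non-negative integer $n$, the binomial coefficient is defined by $$\binom{x}{n} \, = \, \frac{1}{n!}\, x(x-1)\cdots(x-n+1) \, .$$ *)

theory Defs
  imports Complex_Main
begin

end

theory Submission
  imports Defs "HOL-Analysis.Convex"
begin

text \<open>
  Put \<open>t = \<beta> - 1\<close>. Both sides agree at \<open>\<beta> = 1\<close>, and divided by that common value they become
  the products of \<open>1 + t a / (a + 1 + i)\<close> over \<open>i < b\<close> and of \<open>1 + t b / (b + 1 + j)\<close> over \<open>j < a\<close>.
  Raise both to the power \<open>a b\<close> and index the factors by \<open>k < a b\<close> through \<open>i = k div a\<close> and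
  \<open>j = k div b\<close>; then they compare one by one. By Bernoulli,
  \<open>(1 + a y)\<^sup>b \<ge> (1 + b y)\<^sup>a\<close> for \<open>y \<ge> 0\<close>, and \<open>a + k div a \<le> b + k div b\<close>.
\<close>

text \<open>Weighted AM-GM for \<open>1 + b y\<close> and \<open>1\<close>, with weights
  \<open>a / b\<close> and \<open>1 - a / b\<close>, followed by raising to the power
  \<open>b\<close>.\<close>

lemma Bernoulli_power_le:
  fixes y :: real and a b :: nat
  assumes "a \<le> b" "0 \<le> y"
  shows "(1 + real b * y) ^ a \<le> (1 + real a * y) ^ b"
proof (cases "b = 0")
  case True
  then show ?thesis using assms by simp
next
  case False
  define z where "z = 1 + real b * y"
  have z: "z > 0"
    using assms by (simp add: z_def add_pos_nonneg)
  have "z powr (a / b) \<le> a / b * z + (1 - a / b)"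
    using Youngs_inequality_0[of "a / b" "1 - a / b" z 1] assms False z by simp
  also have "\<dots> = 1 + real a * y"
    using False by (simp add: z_def field_simps)
  finally have "z powr (a / b) \<le> 1 + real a * y" .
  then have "(z powr (a / b)) ^ b \<le> (1 + real a * y) ^ b"
    by (intro power_mono) auto
  also have "(z powr (a / b)) ^ b = z ^ a"
    using z False by (simp add: powr_realpow[symmetric] powr_powr)
  finally show ?thesis by (simp add: z_def)
qed

lemma add_div_le_add_div:
  fixes a b k :: nat
  assumes "0 < a" "a \<le> b" "k < a * b"
  shows "a + k div a \<le> b + k div b"
proof -
  obtain d where b: "b = a + d"
    using assms(2) le_Suc_ex by blast
  define q where "q = k div b"
  have q: "q < a"
    using assms by (simp add: q_def less_mult_imp_div_less)
  then obtain e where a: "a = Suc (q + e)"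
    using less_imp_Suc_add by blast
  have "k < b * Suc q"
    using assms by (simp add: q_def dividend_less_times_div)
  \<comment> \<open>The right side exceeds the left by \<open>d * e\<close>, where
    \<open>e = a - (q + 1)\<close>.\<close>
  also have "b * Suc q \<le> Suc (d + q) * a"
    by (simp add: b a algebra_simps)
  finally have "k div a < Suc (d + q)"
    by (rule less_mult_imp_div_less)
  then show ?thesis by (simp add: b q_def)
qed

text \<open>\<open>k div m\<close> equals \<open>i\<close> exactly on the block of \<open>m\<close>
  consecutive indices starting at \<open>i * m\<close>.\<close>

lemma prod_div:
  fixes f :: "nat \<Rightarrow> 'a::comm_semiring_1"
  assumes "0 < m"
  shows "(\<Prod>k<n * m. f (k div m)) = (\<Prod>i<n. f i) ^ m"
proof -
  have "(\<Prod>k<n * m. f (k div m)) = (\<Prod>i<n. \<Prod>k\<in>{i * m..<i * m + m}. f (k div m))"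
    by (rule prod.nat_group[symmetric])
  also have "\<dots> = (\<Prod>i<n. \<Prod>k\<in>{i * m..<i * m + m}. f i)"
    by (intro prod.cong refl arg_cong[where f = f] div_nat_eqI)
      (auto simp: mult.commute)
  finally show ?thesis by (simp add: prod_power_distrib)
qed

lemma prod_ratio_le:
  fixes t :: real and a b :: nat
  assumes "0 \<le> t" "0 < a" "a \<le> b"
  shows "(\<Prod>j<a. 1 + t * b / (b + 1 + j)) \<le> (\<Prod>i<b. 1 + t * a / (a + 1 + i))"
    (is "prod ?R _ \<le> prod ?L _")
proof -
  have "?R (k div b) ^ a \<le> ?L (k div a) ^ b" if "k < a * b" for k
  proof -
    have le: "real (a + 1 + k div a) \<le> real (b + 1 + k div b)"
      using add_div_le_add_div[OF assms(2,3) that] by linarith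
    \<comment> \<open>Passing to the smaller denominator lets both factors share the same
      \<open>y = t / (a + 1 + k div a)\<close> in Bernoulli.\<close>
    have "?R (k div b) \<le> 1 + real b * (t / (a + 1 + k div a))"
      using assms le by (simp add: divide_left_mono mult.commute)
    then have "?R (k div b) ^ a \<le> (1 + real b * (t / (a + 1 + k div a))) ^ a"
      using assms by (intro power_mono) auto
    also have "\<dots> \<le> (1 + real a * (t / (a + 1 + k div a))) ^ b"
      using assms by (intro Bernoulli_power_le) auto
    finally show ?thesis by (simp add: mult.commute)
  qed
  then have "(\<Prod>k<a * b. ?R (k div b) ^ a) \<le> (\<Prod>k<b * a. ?L (k div a) ^ b)"
    using assms by (subst mult.commute[of b a], intro prod_mono) auto
  \<comment> \<open>Each factor occurs for \<open>b\<close> values of \<open>k\<close>, each time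
    with exponent \<open>a\<close>; for \<open>?L\<close> the roles of \<open>a\<close> and
    \<open>b\<close> are exchanged.\<close>
  moreover have "(\<Prod>k<a * b. ?R (k div b) ^ a) = prod ?R {..<a} ^ (a * b)"
    using assms prod_div[of b "\<lambda>j. ?R j ^ a" a]
    by (simp add: prod_power_distrib[symmetric] power_mult)
  moreover have "(\<Prod>k<b * a. ?L (k div a) ^ b) = prod ?L {..<b} ^ (a * b)"
    using assms prod_div[of a "\<lambda>i. ?L i ^ b" b]
    by (simp add: prod_power_distrib[symmetric] power_mult mult.commute[of a b])
  ultimately have "prod ?R {..<a} ^ (a * b) \<le> prod ?L {..<b} ^ (a * b)"
    by simp
  moreover have "0 \<le> prod ?R {..<a}" "0 \<le> prod ?L {..<b}"
    using assms by (auto intro!: prod_nonneg)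
  ultimately show ?thesis using assms by simp
qed

text \<open>The numerator on the left is the rising product of \<open>\<beta> m + 1 + i\<close> over
  \<open>i < n\<close>. Taking \<open>m + 1 + i\<close> out of each factor leaves the stated
  product, and what is taken out, over \<open>n!\<close>, is the integer binomial, the value at
  \<open>\<beta> = 1\<close>.\<close>

lemma gbinomial_eq_binomial_times_prod:
  fixes \<beta> :: real and m n :: nat
  shows "(real n + \<beta> * real m) gchoose n =
    real ((m + n) choose n) * (\<Prod>i<n. 1 + (\<beta> - 1) * m / (m + 1 + i))"
proof -
  have "pochhammer (\<beta> * m + 1) n = (\<Prod>i<n. real (m + 1 + i) * (1 + (\<beta> - 1) * m / (m + 1 + i)))"
    unfolding pochhammer_prod atLeast0LessThan
    by (intro prod.cong refl) (simp add: field_simps)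
  also have "\<dots> = pochhammer (real m + 1) n * (\<Prod>i<n. 1 + (\<beta> - 1) * m / (m + 1 + i))"
    by (simp add: prod.distrib pochhammer_prod atLeast0LessThan add_ac)
  finally show ?thesis
    by (simp add: gbinomial_pochhammer' binomial_gbinomial)
qed

theorem theorem2:
  fixes \<beta> :: real and a b :: nat
  assumes "\<beta> \<ge> 1" and "a \<ge> 1" and "b > a"
  shows "(real b + \<beta> * real a) gchoose b \<ge> (real a + \<beta> * real b) gchoose a"
proof -
  have "(b + a) choose a = (a + b) choose b"
    using binomial_symmetric[of a "a + b"] by (simp add: add.commute)
  moreover have "(\<Prod>j<a. 1 + (\<beta> - 1) * b / (b + 1 + j)) \<le> (\<Prod>i<b. 1 + (\<beta> - 1) * a / (a + 1 + i))"
    using assms by (intro prod_ratio_le) auto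
  ultimately show ?thesis
    unfolding gbinomial_eq_binomial_times_prod by (simp add: mult_left_mono)
qed

end
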